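(* Let $n$ be odd and $k=2$. For every $u\in\mathbb{F}_{2^n}^*$ with $v_u=1$, the unique nonzero element $w_u$ of $V_u$ satisfies $T(u,w_u)=1$; moreover, no $u\in\mathbb{F}_{2^n}^*$ with $v_u=3$ has $T(u,\cdot)\equiv0$ on $V_u$. Consequently: (i) $G_1(u)=0$ for every $u\in\mathbb{F}_{2^n}$; (ii) $g(x)=x(x+1)^5=\operatorname{MCM}(x)$ is exactly $2$-to-$1$ on $\mathbb{F}_{2^n}$, each (nonempty) fiber containing one element of $H_0$ and one of $H_1$; in particular $\operatorname{MCM}(H_0)=\operatorname{MCM}(H_1)=\Delta$; (iii) $2S(u)=H(u)=G_0(u)=\sum_{s\in\mathbb{F}_{2^n}}\chi\bigl(u\,g(s)\bigr)$ for all $u\neq0$.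
   Context: $\mathbb{F}_{2^n}$ is the field with $2^n$ elements ($n$ odd), $\operatorname{Tr}(x)=\sum_{i=0}^{n-1}x^{2^i}$ is the absolute trace, $\chi(x)=(-1)^{\operatorname{Tr}(x)}$, and $H_i=\{x:\operatorname{Tr}(x)=i\}$ for $i\in\{0,1\}$. For $k=2$: $F(x)=x^{13}$, $\delta(b)=F(b)+F(b+1)+1$, $\Delta=\{\delta(b): b\in\mathbb{F}_{2^n}\}$, $S(a)=\sum_{t\in\Delta}\chi(at)$, $H(u)=\sum_{b\in\mathbb{F}_{2^n}}\chi(u\,\delta(b))$, and the Müller–Cohen–Matthews polynomial is $\operatorname{MCM}(x)=(x+x^2)^5/x^4=x(x+1)^5=:g(x)$. For $\varepsilon\in\{0,1\}$, $G_\varepsilon(u)=\sum_{s\in\mathbb{F}_{2^n}}\chi(u\,g(s)+\varepsilon s)$. For $u\neq0$, with $\sqrt u$ the unique square root of $u$, let $Q_u(s)=\operatorname{Tr}(us^5+\sqrt u\,s^3)$, let $V_u=\{w: Q_u(s+w)+Q_u(s)+Q_u(w)=0\ \forall s\in\mathbb{F}_{2^n}\}$ be its radical (an $\mathbb{F}_2$-subspace), $v_u=\dim_{\mathbb{F}_2}V_u$, and $T(u,w)=\operatorname{Tr}(w+u\,g(w))$ for $w\in V_u$. *)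

theory Defs
  imports
    "HOL-Computational_Algebra.Computational_Algebra"
    "HOL-Library.Cardinality"
    "HOL-Library.Z2"
begin

text \<open>
  The field with \<open>2 ^ n\<close> elements is a type \<open>'a :: {finite, field}\<close> with \<open>CARD('a) = 2 ^ n\<close>.
  The prime field of \<open>'a\<close> is the set \<open>{0, 1}\<close>, and the trace takes its values there.
\<close>

definition Tr :: "nat \<Rightarrow> 'a \<Rightarrow> 'a::{finite,field}" where
  "Tr n x = (\<Sum>i<n. x ^ (2 ^ i))"

text \<open>\<open>(-1) ^ Tr x\<close>, the exponent being read as the integer 0 or 1.\<close>

definition chi :: "nat \<Rightarrow> 'a::{finite,field} \<Rightarrow> int" where
  "chi n x = (if Tr n x = 0 then 1 else -1)"

definition trace_fiber :: "nat \<Rightarrow> 'a \<Rightarrow> 'a::{finite,field} set" where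
  "trace_fiber n i = {x. Tr n x = i}"

definition F :: "'a \<Rightarrow> 'a::{finite,field}" where
  "F x = x ^ 13"

definition delta :: "'a \<Rightarrow> 'a::{finite,field}" where
  "delta b = F b + F (b + 1) + 1"

definition Delta :: "'a::{finite,field} set" where
  "Delta = range delta"

definition S :: "nat \<Rightarrow> 'a::{finite,field} \<Rightarrow> int" where
  "S n a = (\<Sum>t\<in>Delta. chi n (a * t))"

definition H :: "nat \<Rightarrow> 'a::{finite,field} \<Rightarrow> int" where
  "H n u = (\<Sum>b\<in>UNIV. chi n (u * delta b))"

text \<open>The polynomial \<open>(x + x\<^sup>2)\<^sup>5 / x\<^sup>4\<close>; the division is exact.\<close>

definition MCM :: "'a::{finite,field} poly" where
  "MCM = ([:0, 1:] + [:0, 1:]\<^sup>2) ^ 5 div [:0, 1:] ^ 4"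

definition g :: "'a \<Rightarrow> 'a::{finite,field}" where
  "g x = x * (x + 1) ^ 5"

definition G :: "nat \<Rightarrow> 'a \<Rightarrow> 'a::{finite,field} \<Rightarrow> int" where
  "G n e u = (\<Sum>s\<in>UNIV. chi n (u * g s + e * s))"

definition field_sqrt :: "'a \<Rightarrow> 'a::{finite,field}" where
  "field_sqrt u = (THE v. v\<^sup>2 = u)"

definition Q :: "nat \<Rightarrow> 'a \<Rightarrow> 'a \<Rightarrow> 'a::{finite,field}" where
  "Q n u s = Tr n (u * s ^ 5 + field_sqrt u * s ^ 3)"

definition V :: "nat \<Rightarrow> 'a \<Rightarrow> 'a::{finite,field} set" where
  "V n u = {w. \<forall>s. Q n u (s + w) + Q n u s + Q n u w = 0}"

text \<open>Scalar multiplication making a field of characteristic 2 a vector space over \<open>bit\<close>.\<close>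

definition bit_scale :: "bit \<Rightarrow> 'a \<Rightarrow> 'a::{finite,field}" where
  "bit_scale c x = (if c = 0 then 0 else x)"

definition v :: "nat \<Rightarrow> 'a::{finite,field} \<Rightarrow> nat" where
  "v n u = vector_space.dim bit_scale (V n u)"

definition T :: "nat \<Rightarrow> 'a \<Rightarrow> 'a \<Rightarrow> 'a::{finite,field}" where
  "T n u w = Tr n (w + u * g w)"

lemma char_2:
  assumes "CARD('a::{finite,field}) = 2 ^ n"
  shows "x + x = (0::'a)"
proof -
  have "(\<Sum>x\<in>UNIV. x + 1) = (\<Sum>x\<in>UNIV. x :: 'a)"
    by (rule sum.reindex_bij_witness[of _ "\<lambda>x. x - 1" "\<lambda>x. x + 1"]) auto
  then have "of_nat CARD('a) = (0::'a)"
    by (simp add: sum.distrib)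
  then have "(2::'a) = 0"
    by (simp add: assms)
  then show ?thesis
    by (simp flip: mult_2)
qed

lemma vector_space_bit_scale:
  assumes "CARD('a::{finite,field}) = 2 ^ n"
  shows "vector_space (bit_scale :: bit \<Rightarrow> 'a \<Rightarrow> 'a)"
proof
  fix a b :: bit and x :: 'a
  show "bit_scale (a + b) x = bit_scale a x + bit_scale b x"
    by (cases a; cases b) (auto simp: bit_scale_def char_2[OF assms])
qed (auto simp: bit_scale_def)

lemma subspace_V:
  fixes u :: "'a::{finite,field}"
  assumes "CARD('a) = 2 ^ n"
  shows "module.subspace bit_scale (V n u)"
proof -
  interpret vector_space "bit_scale :: bit \<Rightarrow> 'a \<Rightarrow> 'a"
    by (rule vector_space_bit_scale[OF assms])
  have eq: "x + y + z = 0 \<longleftrightarrow> x = y + z" for x y z :: 'a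
    unfolding add.assoc[of x y z] add_eq_0_iff2[of x "y + z"]
      minus_unique[OF char_2[OF assms, of "y + z"]] ..
  have zero: "0 \<in> V n u"
    by (simp add: V_def Q_def Tr_def char_2[OF assms] power_0_left)
  have "x + y \<in> V n u" if "x \<in> V n u" "y \<in> V n u" for x y
  proof -
    have "Q n u (s + x) = Q n u s + Q n u x" "Q n u (s + y) = Q n u s + Q n u y" for s
      using that by (simp_all add: V_def eq)
    then show ?thesis
      by (simp add: V_def eq add.assoc[symmetric])
  qed
  with zero show ?thesis
    by (auto simp: subspace_def bit_scale_def)
qed

lemma ex1_sqrt:
  fixes u :: "'a::{finite,field}"
  assumes "CARD('a) = 2 ^ n"
  shows "\<exists>!x. x\<^sup>2 = u"
proof -
  have "x = y" if "x\<^sup>2 = y\<^sup>2" for x y :: 'a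
    using that minus_unique[OF char_2[OF assms, of y]] by (simp add: power2_eq_iff)
  then have "inj (\<lambda>x::'a. x\<^sup>2)"
    by (auto intro: injI)
  then have "bij (\<lambda>x::'a. x\<^sup>2)"
    by (simp add: bij_def finite_UNIV_inj_surj)
  then show ?thesis
    unfolding bij_iff by blast
qed

end

theory Submission
  imports Defs
begin

text \<open>
  Since \<open>n\<close> is odd, 5 is coprime to \<open>2 ^ n - 1\<close>, so every element is a fifth power, and
  \<open>g (y\<^sup>5) = (y + y\<^sup>6)\<^sup>5\<close>. For \<open>y \<noteq> 0\<close> and \<open>d \<noteq> 0\<close>, the elements \<open>y\<close> and \<open>y + d\<close> have the same
  image under \<open>y + y\<^sup>6\<close> iff \<open>y\<^sup>5 D\<^sub>5 (d / y) = 1\<close>, where the Dickson polynomial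
  \<open>D\<^sub>5 t = t\<^sup>5 + t\<^sup>3 + t\<close> permutes the field. Hence \<open>g\<close> is 2-to-1, and the two elements of a fiber
  have traces 0 and 1 because their sum is \<open>1 + w + w\<^sup>2\<close> for some \<open>w\<close>. As \<open>delta b = g (b\<^sup>2 + b)\<close>
  and \<open>b\<^sup>2 + b\<close> runs twice through the elements of trace 0, all claims on \<open>Delta\<close>, \<open>S\<close>, \<open>H\<close> and
  \<open>G\<close> follow. Finally, the claims on the radical are deduced from \<open>G n 1 u = 0\<close>:
  the square of this sum is \<open>2 ^ n\<close> times the sum of \<open>(-1) ^ T n u w\<close> over \<open>w\<close> in \<open>V n u\<close>, which is
  positive if \<open>T n u\<close> vanishes on \<open>V n u\<close>.
\<close>

locale odd_binary_field =
  fixes n :: nat and field_type :: "'a::{finite,field} itself"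
  assumes odd_n: "odd n" and card_field: "CARD('a) = 2 ^ n"
begin

section \<open>Arithmetic in characteristic 2\<close>

lemma add_self [simp]: "x + x = (0::'a)"
  by (rule char_2[OF card_field])

lemma add_self_left [simp]: "x + (x + y) = (y::'a)"
  by (simp add: add.assoc[symmetric])

lemma uminus_eq [simp]: "- x = (x::'a)"
  by (rule minus_unique[OF add_self])

lemma diff_eq [simp]: "x - y = (x + y::'a)"
  using diff_conv_add_uminus[of x y] by simp

lemma add_eq_0_iff_eq [simp]: "x + y = 0 \<longleftrightarrow> x = (y::'a)"
  by (simp add: add_eq_0_iff2)

lemma two_eq_0 [simp]: "2 = (0::'a)"
  by (metis add_self one_add_one)

lemma square_add: "(x + y) ^ 2 = x ^ 2 + (y::'a) ^ 2"
  by (simp add: power2_sum)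

lemma power4_add: "(x + y) ^ 4 = x ^ 4 + (y::'a) ^ 4"
  using square_add[of "x^2" "y^2"] by (simp add: square_add[symmetric] flip: power_mult)

lemma power8_add: "(x + y) ^ 8 = x ^ 8 + (y::'a) ^ 8"
  using square_add[of "x^4" "y^4"] by (simp add: power4_add[symmetric] flip: power_mult)

text \<open>The exponents are split in binary, so that each factor is a Frobenius power of the sum
  and has only two terms.\<close>

lemma pow_add:
  "(x + y) ^ 3 = (x ^ 2 + y ^ 2) * (x + (y::'a))"
  "(x + y) ^ 5 = (x ^ 4 + y ^ 4) * (x + y)"
  "(x + y) ^ 6 = (x ^ 4 + y ^ 4) * (x ^ 2 + y ^ 2)"
  "(x + y) ^ 13 = (x ^ 8 + y ^ 8) * ((x ^ 4 + y ^ 4) * (x + y))"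
  unfolding square_add[symmetric] power4_add[symmetric] power8_add[symmetric]
  by (simp_all flip: power_add power_Suc2 power_Suc)

lemma frobenius_add: "(x + y) ^ (2 ^ i) = x ^ (2 ^ i) + (y::'a) ^ (2 ^ i)"
  by (induction i) (simp_all add: power_mult square_add mult.commute[of 2])

lemmas expand_sums = pow_add square_add power4_add power8_add power_mult_distrib power_one
  power_mult[symmetric] distrib_left distrib_right

lemmas expand_powers = eval_nat_numeral distrib_left distrib_right mult_ac add_ac

section \<open>Consequences of the field order\<close>

text \<open>Multiplication by a nonzero \<open>x\<close> permutes the nonzero elements; compare
  their products.\<close>

lemma power_card: "x ^ (2 ^ n) = (x::'a)"
proof (cases "x = 0")
  case False
  have "(\<Prod>y\<in>UNIV - {0}. x * y) = (\<Prod>y\<in>UNIV - {0}. y)"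
    by (rule prod.reindex_bij_witness[of _ "\<lambda>y. y / x" "\<lambda>y. x * y"]) (use False in auto)
  then have "x ^ (CARD('a) - 1) = 1"
    by (simp add: prod.distrib card_Diff_singleton)
  moreover have "Suc (2 ^ n - 1) = (2::nat) ^ n"
    by simp
  ultimately show ?thesis
    by (metis card_field mult.right_neutral power_Suc)
qed simp

text \<open>A primitive cube root of unity lies in the field with 4 elements, which is not a subfield for odd \<open>n\<close>.\<close>

lemma no_cube_root: "z\<^sup>2 + z + 1 \<noteq> (0::'a)"
proof
  assume z: "z\<^sup>2 + z + 1 = 0"
  then have z2: "z\<^sup>2 = z + 1"
    by (simp add: add.assoc)
  have "z ^ 4 = (z\<^sup>2)\<^sup>2"
    by (simp flip: power_mult)
  also have "\<dots> = z"
    by (simp add: z2 square_add add.assoc)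
  finally have z4: "z ^ 4 = z" .
  have "z ^ (4 ^ k) = z" for k
    by (induction k) (simp_all add: power_mult z4)
  \<comment> \<open>As \<open>n\<close> is odd, raising to the power \<open>2 ^ n\<close> squares
    \<open>z\<close>, although it must fix \<open>z\<close>.\<close>
  moreover obtain k where "n = Suc (2 * k)"
    using odd_n oddE by fastforce
  then have "2 ^ n = 4 ^ k * (2::nat)"
    by (simp add: power_mult)
  ultimately have "z ^ (2 ^ n) = z\<^sup>2"
    by (simp only: power_mult)
  then have "z\<^sup>2 = z"
    by (simp add: power_card)
  with z show False
    by simp
qed

section \<open>Permutations obtained from an anisotropic norm form\<close>

text \<open>If \<open>t\<close> were nonzero, \<open>s / t\<close> would be a primitive cube root of
  unity.\<close>

lemma norm_form_eq_0:
  assumes "s\<^sup>2 + s * t + t\<^sup>2 = (0::'a)"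
  shows "s = 0" "t = 0"
proof -
  show "t = 0"
  proof (rule ccontr)
    assume "t \<noteq> 0"
    then have "(s / t)\<^sup>2 + s / t + 1 = (s\<^sup>2 + s * t + t\<^sup>2) / t\<^sup>2"
      by (simp add: field_simps power2_eq_square)
    with assms no_cube_root show False
      by simp
  qed
  with assms show "s = 0"
    by simp
qed

text \<open>The quotient of \<open>a ^ 5 + b ^ 5\<close> by \<open>a + b\<close> is the norm form at
  \<open>(a + b)\<^sup>2\<close> and \<open>a * b\<close>.\<close>

lemma power5_eq_iff [simp]: "a ^ 5 = b ^ 5 \<longleftrightarrow> a = (b::'a)"
proof
  assume eq: "a ^ 5 = b ^ 5"
  show "a = b"
  proof (rule ccontr)
    assume "a \<noteq> b"
    have "(a + b) * (((a + b)\<^sup>2)\<^sup>2 + (a + b)\<^sup>2 * (a * b) + (a * b)\<^sup>2) = a ^ 5 + b ^ 5"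
      by (simp only: expand_sums) (simp add: expand_powers)
    with eq \<open>a \<noteq> b\<close> have "((a + b)\<^sup>2)\<^sup>2 + (a + b)\<^sup>2 * (a * b) + (a * b)\<^sup>2 = 0"
      by (metis add_eq_0_iff_eq mult_eq_0_iff)
    from norm_form_eq_0(1)[OF this] \<open>a \<noteq> b\<close> show False
      by simp
  qed
qed simp

lemma surj_power5: "surj (\<lambda>x::'a. x ^ 5)"
  by (rule finite_UNIV_inj_surj) (simp_all add: inj_on_def)

definition D5 :: "'a \<Rightarrow> 'a" where
  "D5 t = t ^ 5 + t ^ 3 + t"

text \<open>\<open>D5\<close> is the Dickson polynomial of degree 5. Its divided difference is
  \<open>(p + 1)\<^sup>2 + (p + 1) (e + 1) + (e + 1)\<^sup>2\<close> with \<open>p = a b\<close> and \<open>e = (a + b)\<^sup>2\<close>.\<close>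

lemma inj_D5: "inj D5"
proof (rule injI, rule ccontr)
  fix a b :: 'a
  assume eq: "D5 a = D5 b" and "a \<noteq> b"
  have "(a + b) * ((a * b + 1)\<^sup>2 + (a * b + 1) * ((a + b)\<^sup>2 + 1) + ((a + b)\<^sup>2 + 1)\<^sup>2) = D5 a + D5 b"
    by (simp only: D5_def expand_sums) (simp add: expand_powers)
  with eq \<open>a \<noteq> b\<close> have *: "(a * b + 1)\<^sup>2 + (a * b + 1) * ((a + b)\<^sup>2 + 1) + ((a + b)\<^sup>2 + 1)\<^sup>2 = 0"
    by (metis add_eq_0_iff_eq mult_eq_0_iff)
  have ab: "a * b = 1" and "(a + b)\<^sup>2 = 1"
    using norm_form_eq_0[OF *] by simp_all
  then have "a + b = 1"
    by (metis ex1_sqrt[OF card_field] one_power2)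
  then have "b = a + 1"
    by (metis add_self_left)
  with ab have "a\<^sup>2 + a + 1 = 0"
    by (simp add: power2_eq_square distrib_left)
  with no_cube_root show False
    by blast
qed

lemma surj_D5: "surj D5"
  by (rule finite_UNIV_inj_surj[OF finite inj_D5])

section \<open>The absolute trace\<close>

lemma Tr_add: "Tr n (x + y) = Tr n x + Tr n (y::'a)"
  by (simp add: Tr_def frobenius_add sum.distrib)

lemma Tr_0 [simp]: "Tr n (0::'a) = 0"
  by (simp add: Tr_def power_0_left)

lemma Tr_1 [simp]: "Tr n (1::'a) = 1"
proof -
  obtain k where "n = 2 * k + 1"
    using odd_n oddE by blast
  then show ?thesis
    by (simp add: Tr_def)
qed

text \<open>Squaring shifts the summands cyclically, because \<open>x ^ (2 ^ n) = x\<close>.\<close>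

lemma Tr_square [simp]: "Tr n (x\<^sup>2) = Tr n (x::'a)"
proof -
  have "Tr n (x\<^sup>2) = (\<Sum>i<n. x ^ (2 ^ Suc i))"
    by (simp add: Tr_def power_mult)
  moreover have "(\<Sum>i<Suc n. x ^ (2 ^ i)) = x + (\<Sum>i<n. x ^ (2 ^ Suc i))"
    by (subst sum.lessThan_Suc_shift) simp
  ultimately have "x + Tr n (x\<^sup>2) = x + Tr n x"
    by (simp add: Tr_def power_card add.commute)
  then show ?thesis
    by simp
qed

lemma square_Tr: "(Tr n x)\<^sup>2 = Tr n (x::'a)"
proof -
  have "(\<Sum>i\<in>A. f i)\<^sup>2 = (\<Sum>i\<in>A. (f i)\<^sup>2)" for A :: "nat set" and f :: "nat \<Rightarrow> 'a"
    by (induction A rule: infinite_finite_induct) (simp_all add: square_add)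
  then have "(Tr n x)\<^sup>2 = Tr n (x\<^sup>2)"
    by (simp add: Tr_def power_mult[symmetric] mult.commute)
  then show ?thesis
    by simp
qed

lemma Tr_cases: "Tr n x = 0 \<or> Tr n x = (1::'a)"
proof -
  have "Tr n x * (Tr n x + 1) = 0"
    using square_Tr[of x] by (simp add: distrib_left power2_eq_square)
  then show ?thesis
    by auto
qed

text \<open>The half trace \<open>x + x\<^sup>4 + \<dots> + x ^ 2\<^bsup>n - 1\<^esup>\<close> solves \<open>b\<^sup>2 + b = x\<close>.\<close>

lemma trace_fiber_0_eq: "trace_fiber n 0 = range (\<lambda>b::'a. b\<^sup>2 + b)"
proof (intro set_eqI iffI)
  fix x :: 'a
  assume "x \<in> trace_fiber n 0"
  then have Tr: "Tr n x = 0"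
    by (simp add: trace_fiber_def)
  obtain m where m: "n = 2 * m + 1"
    using odd_n oddE by blast
  define h where "h k = (\<Sum>i\<le>k. x ^ (4 ^ i))" for k
  have "(h k)\<^sup>2 + h k = (\<Sum>j<2 * k + 2. x ^ (2 ^ j))" for k
  proof (induction k)
    case (Suc k)
    have exps: "2 ^ (2 * k + 2) = (4::nat) ^ Suc k" "2 ^ (2 * k + 3) = (4::nat) ^ Suc k * 2"
      by (simp_all add: power_add power_mult)
    have "(h (Suc k))\<^sup>2 + h (Suc k) =
        (h k)\<^sup>2 + h k + x ^ (4 ^ Suc k) + (x ^ (4 ^ Suc k))\<^sup>2"
      by (simp add: h_def square_add del: power_Suc)
    also have "\<dots> = (\<Sum>j<2 * k + 2. x ^ (2 ^ j)) + x ^ (2 ^ (2 * k + 2)) + x ^ (2 ^ (2 * k + 3))"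
      unfolding exps power_mult[of x "4 ^ Suc k" 2] Suc ..
    also have "\<dots> = (\<Sum>j<2 * Suc k + 2. x ^ (2 ^ j))"
      by (simp add: numeral_3_eq_3)
    finally show ?case .
  qed (simp add: h_def numeral_2_eq_2 add.commute)
  \<comment> \<open>Here \<open>2 * m + 2 = n + 1\<close>: the sum has one term more than the trace,
    and that term equals \<open>x\<close>.\<close>
  from this[of m] have "(h m)\<^sup>2 + h m = Tr n x + x ^ (2 ^ n)"
    by (simp add: m Tr_def)
  then have "x = (h m)\<^sup>2 + h m"
    by (simp add: Tr power_card)
  then show "x \<in> range (\<lambda>b. b\<^sup>2 + b)"
    by (rule range_eqI)
qed (auto simp: trace_fiber_def Tr_add)

section \<open>Fibers of \<open>g\<close>\<close>

lemma delta_eq: "delta b = g (b\<^sup>2 + b :: 'a)"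
  by (simp only: delta_def F_def g_def expand_sums) (simp add: expand_powers)

lemma Delta_eq: "Delta = g ` trace_fiber n (0::'a)"
  by (simp add: Delta_def trace_fiber_0_eq delta_eq image_image)

lemma g_power5: "g (y ^ 5) = (y + y ^ 6 :: 'a) ^ 5"
proof -
  have "y + y ^ 6 = y * (y ^ 5 + 1)"
    by (simp add: distrib_left add.commute flip: power_Suc)
  then show ?thesis
    by (simp add: g_def power_mult_distrib)
qed

lemma collision_iff:
  assumes "d \<noteq> (0::'a)"
  shows "(y + d) + (y + d) ^ 6 = y + y ^ 6 \<longleftrightarrow> y ^ 4 * d + y\<^sup>2 * d ^ 3 + d ^ 5 = 1"
proof -
  have "(y + d) + (y + d) ^ 6 + (y + y ^ 6) = d * (y ^ 4 * d + y\<^sup>2 * d ^ 3 + d ^ 5 + 1)"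
    by (simp only: expand_sums) (simp add: expand_powers)
  with assms show ?thesis
    by (metis add_eq_0_iff_eq mult_eq_0_iff)
qed

text \<open>For \<open>y \<noteq> 0\<close>, scaling \<open>d = t * y\<close> turns the left side
  into \<open>y ^ 5 * D5 t\<close>, and \<open>D5\<close> is a permutation. For \<open>y = 0\<close>
  the equation is \<open>d ^ 5 = 1\<close>.\<close>

lemma ex1_collision: "\<exists>!d::'a. y ^ 4 * d + y\<^sup>2 * d ^ 3 + d ^ 5 = 1"
proof (cases "y = 0")
  case True
  then show ?thesis
    using power5_eq_iff[of _ 1] by (auto simp: power_0_left)
next
  case False
  have eq: "y ^ 4 * d + y\<^sup>2 * d ^ 3 + d ^ 5 = y ^ 5 * D5 (d / y)" for d
    using False by (simp add: D5_def field_simps eval_nat_numeral)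
  have iff: "y ^ 5 * D5 (d / y) = 1 \<longleftrightarrow> D5 (d / y) = 1 / y ^ 5" for d
    using False by (simp add: field_simps)
  obtain t where t: "D5 t = 1 / y ^ 5"
    using surj_D5 by (metis surjD)
  show ?thesis
    unfolding eq iff
  proof (rule ex1I[of _ "t * y"])
    fix d assume "D5 (d / y) = 1 / y ^ 5"
    with t have "d / y = t"
      using inj_D5 by (simp add: inj_def)
    with False show "d = t * y"
      by (simp add: field_simps)
  qed (use False t in simp)
qed

text \<open>With \<open>w = d\<^sup>3 (y\<^sup>2 + y d + d\<^sup>2)\<close> the collision equation gives \<open>w\<^sup>2 = d\<^sup>5\<close>, and then
  \<open>y\<^sup>5 + (y + d)\<^sup>5 = 1 + w + w\<^sup>2\<close>.\<close>

lemma Tr_collision: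
  assumes eq: "y ^ 4 * d + y\<^sup>2 * d ^ 3 + d ^ 5 = (1::'a)"
  shows "Tr n ((y + d) ^ 5) = Tr n (y ^ 5) + 1"
proof -
  define w where "w = d ^ 3 * (y\<^sup>2 + y * d + d\<^sup>2)"
  have "w\<^sup>2 = d ^ 5 * (y ^ 4 * d + y\<^sup>2 * d ^ 3 + d ^ 5)"
    by (simp only: w_def expand_sums) (simp add: expand_powers)
  then have w2: "w\<^sup>2 = d ^ 5"
    by (simp add: eq)
  have "(y + d) ^ 5 = y ^ 5 + ((y ^ 4 * d + y\<^sup>2 * d ^ 3 + d ^ 5) + w + d ^ 5)"
    by (simp only: w_def expand_sums) (simp add: expand_powers)
  then have "(y + d) ^ 5 = y ^ 5 + (1 + w + w\<^sup>2)"
    by (simp only: eq w2)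
  then show ?thesis
    by (simp add: Tr_add)
qed

lemma fiber_g:
  obtains x' where "g -` {g x} = {x, x'}" and "Tr n x' = Tr n (x::'a) + 1"
proof -
  obtain y where y: "x = y ^ 5"
    using surj_power5 by (metis surjD)
  obtain d where d: "y ^ 4 * d + y\<^sup>2 * d ^ 3 + d ^ 5 = 1"
    and unique: "\<And>e. y ^ 4 * e + y\<^sup>2 * e ^ 3 + e ^ 5 = 1 \<Longrightarrow> e = d"
    using ex1_collision[of y] by blast
  have "d \<noteq> 0"
    using d by auto
  have "g z = g x \<longleftrightarrow> z = x \<or> z = (y + d) ^ 5" for z
  proof -
    \<comment> \<open>Every element has this form, so all preimages are covered by the collision
      equation in \<open>e\<close>.\<close>
    obtain e where z: "z = (y + e) ^ 5"
      using surj_power5 by (metis surjD add_self_left)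
    show ?thesis
    proof (cases "e = 0")
      case False
      then have "g z = g x \<longleftrightarrow> e = d"
        unfolding z y g_power5 power5_eq_iff collision_iff[OF False] using d unique by blast
      with False show ?thesis
        by (simp add: z y)
    qed (simp add: z y)
  qed
  then have "g -` {g x} = {x, (y + d) ^ 5}"
    by auto
  then show thesis
    using that Tr_collision[OF d] y by blast
qed

lemma fiber_g_trace_fiber:
  assumes "y \<in> range (g :: 'a \<Rightarrow> 'a)"
  obtains a b where "g -` {y} = {a, b}" "Tr n a = 0" "Tr n b = 1"
proof -
  obtain x where "y = g x"
    using assms by blast
  moreover obtain x' where "g -` {g x} = {x, x'}" and "Tr n x' = Tr n x + 1"
    by (rule fiber_g)
  ultimately show thesis
    using Tr_cases[of x] that[of x x'] that[of x' x] by (auto simp: insert_commute)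
qed

lemma inj_on_g: "inj_on g (trace_fiber n (i::'a))"
proof (rule inj_onI)
  fix x y :: 'a
  assume *: "x \<in> trace_fiber n i" "y \<in> trace_fiber n i" "g x = g y"
  obtain x' where "g -` {g x} = {x, x'}" and "Tr n x' = Tr n x + 1"
    by (rule fiber_g)
  then show "x = y"
    using * by (auto simp: trace_fiber_def set_eq_iff)
qed

lemma image_g_trace_fiber:
  assumes "i \<in> {0, 1}"
  shows "g ` trace_fiber n i = range (g :: 'a \<Rightarrow> 'a)"
proof -
  have "y \<in> g ` trace_fiber n i" if y: "y \<in> range (g :: 'a \<Rightarrow> 'a)" for y
  proof -
    obtain a b where "g -` {y} = {a, b}" "Tr n a = 0" "Tr n b = 1"
      using fiber_g_trace_fiber[OF y] .
    then show ?thesis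
      using assms by (auto simp: trace_fiber_def set_eq_iff)
  qed
  then show ?thesis
    by blast
qed

lemma image_g_eq_Delta: "i \<in> {0, 1} \<Longrightarrow> g ` trace_fiber n (i::'a) = Delta"
  by (simp add: Delta_eq image_g_trace_fiber)

section \<open>Character sums\<close>

lemma chi_add: "chi n (x + y) = chi n x * chi n (y::'a)"
  using Tr_cases[of x] Tr_cases[of y] by (auto simp: chi_def Tr_add)

lemma chi_cong: "Tr n x = Tr n (y::'a) \<Longrightarrow> chi n x = chi n y"
  by (simp add: chi_def)

text \<open>\<open>g\<close> maps each of the two trace fibers bijectively onto
  \<open>Delta\<close>.\<close>

lemma sum_chi_g:
  assumes "i \<in> {0, 1}"
  shows "(\<Sum>x\<in>trace_fiber n (i::'a). chi n (u * g x)) = S n u"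
  unfolding S_def image_g_eq_Delta[OF assms, symmetric] by (simp add: sum.reindex inj_on_g)

lemma sum_split_Tr:
  fixes f :: "'a \<Rightarrow> int"
  shows "(\<Sum>x\<in>UNIV. f x) = (\<Sum>x\<in>trace_fiber n 0. f x) + (\<Sum>x\<in>trace_fiber n 1. f x)"
proof -
  have "(UNIV::'a set) = trace_fiber n 0 \<union> trace_fiber n 1"
    using Tr_cases by (auto simp: trace_fiber_def)
  then show ?thesis
    by (subst sum.union_disjoint[symmetric]) (auto simp: trace_fiber_def)
qed

lemma G_0: "G n 0 (u::'a) = 2 * S n u"
  unfolding G_def by (simp add: sum_split_Tr sum_chi_g)

text \<open>The extra factor \<open>chi n x\<close> is 1 on trace 0 and -1 on trace 1, so the two
  halves are \<open>S n u\<close> and \<open>- S n u\<close>.\<close>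

lemma G_1: "G n 1 (u::'a) = 0"
proof -
  have "(\<Sum>x\<in>trace_fiber n 0. chi n (u * g x + x)) = S n u"
    unfolding sum_chi_g[of 0, simplified, symmetric]
    by (intro sum.cong refl) (simp add: chi_add, simp add: chi_def trace_fiber_def)
  moreover have "(\<Sum>x\<in>trace_fiber n 1. chi n (u * g x + x)) = - S n u"
    unfolding sum_chi_g[of 1, simplified, symmetric] sum_negf[symmetric]
    by (intro sum.cong refl) (simp add: chi_add, simp add: chi_def trace_fiber_def)
  ultimately show ?thesis
    by (simp add: G_def sum_split_Tr)
qed

text \<open>The map \<open>b\<^sup>2 + b\<close> is 2-to-1 onto the elements of trace 0.\<close>

lemma H_eq: "H n (u::'a) = 2 * S n u"
proof -
  let ?f = "\<lambda>b::'a. b\<^sup>2 + b"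
  have fib: "{b. ?f b = ?f c} = {c, c + 1}" for c
  proof -
    have prod: "?f b + ?f c = (b + c) * (b + (c + 1))" for b
      by (simp only: expand_sums) (simp add: expand_powers)
    have "?f b = ?f c \<longleftrightarrow> b = c \<or> b = c + 1" for b
      using add_eq_0_iff_eq[of "?f b" "?f c"] unfolding prod mult_eq_0_iff add_eq_0_iff_eq by blast
    then show ?thesis
      by auto
  qed
  have "H n u = (\<Sum>b\<in>UNIV. chi n (u * g (?f b)))"
    by (simp add: H_def delta_eq)
  also have "\<dots> = (\<Sum>x\<in>range ?f. \<Sum>b | b \<in> UNIV \<and> ?f b = x. chi n (u * g (?f b)))"
    by (rule sum.image_gen) simp
  also have "\<dots> = (\<Sum>x\<in>range ?f. 2 * chi n (u * g x))"
  proof (rule sum.cong[OF refl], elim imageE)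
    fix x c assume x: "x = ?f c"
    have "(\<Sum>b | b \<in> UNIV \<and> ?f b = x. chi n (u * g (?f b))) = (\<Sum>b\<in>{b. ?f b = ?f c}. chi n (u * g x))"
      by (rule sum.cong) (auto simp: x)
    also have "\<dots> = 2 * chi n (u * g x)"
      by (simp add: fib)
    finally show "(\<Sum>b | b \<in> UNIV \<and> ?f b = x. chi n (u * g (?f b))) = 2 * chi n (u * g x)" .
  qed
  also have "\<dots> = 2 * S n u"
    by (simp add: sum_distrib_left[symmetric] trace_fiber_0_eq[symmetric] sum_chi_g)
  finally show ?thesis .
qed

section \<open>The quadratic form and its radical\<close>

lemma square_field_sqrt: "(field_sqrt u)\<^sup>2 = (u::'a)"
  unfolding field_sqrt_def by (rule theI'[OF ex1_sqrt[OF card_field]])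

text \<open>By invariance of the trace under squaring, \<open>field_sqrt u * s ^ 3\<close> may be
  replaced by \<open>u * s ^ 6\<close>. The remaining term is additive in \<open>s\<close>, so
  \<open>T\<close> and \<open>Q\<close> have the same polar form.\<close>

lemma T_eq: "T n u s = Q n u s + Tr n (u * s\<^sup>2 + u * s + (s::'a))"
proof -
  have "Tr n (field_sqrt u * s ^ 3) = Tr n ((field_sqrt u * s ^ 3)\<^sup>2)"
    by simp
  also have "(field_sqrt u * s ^ 3)\<^sup>2 = u * s ^ 6"
    by (simp add: power_mult_distrib square_field_sqrt flip: power_mult)
  finally have "Q n u s + Tr n (u * s\<^sup>2 + u * s + s) =
      Tr n (u * s ^ 5 + u * s ^ 6 + (u * s\<^sup>2 + u * s + s))"
    by (simp add: Q_def Tr_add)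
  also have "u * s ^ 5 + u * s ^ 6 + (u * s\<^sup>2 + u * s + s) = s + u * g s"
    by (simp only: g_def expand_sums) (simp add: expand_powers)
  finally show ?thesis
    by (simp add: T_def)
qed

text \<open>The trace of \<open>B u w s\<close> is the polar form of \<open>Q n u\<close>.\<close>

definition B :: "'a \<Rightarrow> 'a \<Rightarrow> 'a \<Rightarrow> 'a" where
  "B u w s = u * (s ^ 4 * w + s * w ^ 4) + field_sqrt u * (s\<^sup>2 * w + s * w\<^sup>2)"

lemma Q_polar: "Q n u (s + w) + Q n u s + Q n u w = Tr n (B u w s)"
  unfolding Q_def B_def Tr_add[symmetric] by (simp only: expand_sums) (simp add: expand_powers)

lemma T_polar: "T n u (s + w) = T n u s + T n u w + Tr n (B u w s)"
  by (simp add: T_eq Q_polar[symmetric] Tr_add square_add distrib_left add_ac)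

lemma B_add: "B u w (s + t) = B u w s + B u w t"
  by (simp add: B_def square_add power4_add distrib_left distrib_right add_ac)

lemma V_eq: "V n u = {w. \<forall>s. Tr n (B u w s) = 0}"
  by (simp add: V_def Q_polar)

text \<open>Orthogonality: the summand is an additive character in \<open>s\<close>, trivial exactly
  when \<open>w\<close> lies in the radical.\<close>

lemma sum_chi_B: "(\<Sum>s\<in>UNIV. chi n (B u w s)) = (if w \<in> V n u then 2 ^ n else 0)"
proof (cases "w \<in> V n u")
  case True
  then show ?thesis
    by (simp add: V_eq chi_def card_field)
next
  case False
  then obtain t where "Tr n (B u w t) \<noteq> 0"
    by (auto simp: V_eq)
  then have t: "chi n (B u w t) = -1"
    by (simp add: chi_def)
  have "(\<Sum>s\<in>UNIV. chi n (B u w s)) = (\<Sum>s\<in>UNIV. chi n (B u w (s + t)))"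
    by (rule sum.reindex_bij_witness[of _ "\<lambda>s. s + t" "\<lambda>s. s + t"]) (auto simp: add.assoc)
  also have "\<dots> = - (\<Sum>s\<in>UNIV. chi n (B u w s))"
    by (simp add: B_add chi_add t sum_negf)
  finally show ?thesis
    using False by simp
qed

text \<open>After the substitution \<open>t = s + w\<close>, polarization isolates the dependence on
  \<open>s\<close> in \<open>chi n (B u w s)\<close>; summing over \<open>s\<close> first leaves
  only the radical.\<close>

lemma G_1_square: "(G n 1 (u::'a))\<^sup>2 = 2 ^ n * (\<Sum>w\<in>V n u. chi n (w + u * g w))"
proof -
  let ?q = "\<lambda>s. chi n (s + u * g s)"
  have "(G n 1 u)\<^sup>2 = (\<Sum>s\<in>UNIV. \<Sum>t\<in>UNIV. ?q s * ?q t)"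
    by (simp add: G_def power2_eq_square sum_product add.commute)
  also have "\<dots> = (\<Sum>s\<in>UNIV. \<Sum>w\<in>UNIV. ?q s * ?q (s + w))"
  proof (rule sum.cong[OF refl])
    fix s
    show "(\<Sum>t\<in>UNIV. ?q s * ?q t) = (\<Sum>w\<in>UNIV. ?q s * ?q (s + w))"
      by (rule sum.reindex_bij_witness[of _ "\<lambda>w. s + w" "\<lambda>t. s + t"]) auto
  qed
  also have "\<dots> = (\<Sum>s\<in>UNIV. \<Sum>w\<in>UNIV. ?q w * chi n (B u w s))"
  proof (intro sum.cong refl)
    fix s w
    have "?q s * ?q (s + w) = chi n ((s + u * g s) + ((s + w) + u * g (s + w)))"
      by (simp only: chi_add)
    also have "\<dots> = chi n ((w + u * g w) + B u w s)"
      using T_polar[of u s w] by (intro chi_cong) (simp add: T_def Tr_add add_ac)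
    finally show "?q s * ?q (s + w) = ?q w * chi n (B u w s)"
      by (simp only: chi_add)
  qed
  also have "\<dots> = (\<Sum>w\<in>UNIV. ?q w * (\<Sum>s\<in>UNIV. chi n (B u w s)))"
    by (subst sum.swap) (simp add: sum_distrib_left)
  also have "\<dots> = (\<Sum>w\<in>V n u. ?q w * 2 ^ n)"
    by (rule sum.mono_neutral_cong_right) (auto simp: sum_chi_B)
  finally show ?thesis
    by (simp add: sum_distrib_left mult.commute)
qed

lemma zero_in_V: "0 \<in> V n (u::'a)"
  by (simp add: V_eq B_def)

lemma T_not_zero_on_V: "\<exists>w\<in>V n (u::'a). T n u w \<noteq> 0"
proof (rule ccontr)
  assume "\<not> ?thesis"
  then have "(\<Sum>w\<in>V n u. chi n (w + u * g w)) = int (card (V n u))"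
    by (simp add: chi_def T_def)
  moreover have "card (V n u) > 0"
    using zero_in_V by (auto simp: card_gt_0_iff)
  ultimately show False
    using G_1_square[of u] by (simp add: G_1)
qed

text \<open>A line over the field with two elements consists of 0 and its basis vector.\<close>

lemma V_of_dim_1:
  assumes "v n (u::'a) = 1"
  obtains w where "w \<noteq> 0" "V n u = {0, w}"
proof -
  interpret vector_space "bit_scale :: bit \<Rightarrow> 'a \<Rightarrow> 'a"
    by (rule vector_space_bit_scale[OF card_field])
  obtain A where A: "A \<subseteq> V n u" "independent A" "V n u \<subseteq> span A" "card A = 1"
    using basis_exists[of "V n u"] assms by (metis v_def)
  then obtain w where w: "A = {w}"
    by (auto simp: card_1_singleton_iff)
  have "span A = V n u"
    using A subspace_V[OF card_field] by (metis span_minimal subset_antisym)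
  moreover have "range (\<lambda>k. bit_scale k w) = {0, w}"
    by (force simp: bit_scale_def)
  ultimately show thesis
    using A(2) w that by (auto simp: span_singleton)
qed

lemma V_dim_1:
  assumes "v n (u::'a) = 1"
  shows "\<exists>!w. w \<in> V n u \<and> w \<noteq> 0" "w \<in> V n u \<Longrightarrow> w \<noteq> 0 \<Longrightarrow> T n u w = 1"
proof -
  obtain w0 where V: "w0 \<noteq> 0" "V n u = {0, w0}"
    using V_of_dim_1[OF assms] .
  then show "\<exists>!w. w \<in> V n u \<and> w \<noteq> 0"
    by auto
  have "T n u 0 = 0"
    by (simp add: T_def g_def)
  then have "T n u w0 \<noteq> 0"
    using T_not_zero_on_V[of u] V by auto
  then show "w \<in> V n u \<Longrightarrow> w \<noteq> 0 \<Longrightarrow> T n u w = 1"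
    using V Tr_cases by (auto simp: T_def)
qed

end

section \<open>The polynomial quotient and the conclusion\<close>

lemma poly_MCM: "poly MCM x = g (x::'a::{finite,field})"
proof -
  have "[:0, 1:] + [:0, 1:]\<^sup>2 = [:0, 1:] * ([:1, 1:] :: 'a poly)"
    by (simp add: power2_eq_square)
  then have "([:0, 1:] + [:0, 1:]\<^sup>2) ^ 5 = [:0, 1:] ^ 4 * ([:0, 1:] * [:1, 1:] ^ 5 :: 'a poly)"
    by (simp only: power_mult_distrib) (simp add: eval_nat_numeral)
  then have "MCM = [:0, 1:] * ([:1, 1:] ^ 5 :: 'a poly)"
    unfolding MCM_def by (metis nonzero_mult_div_cancel_left power_not_zero pCons_eq_0_iff one_neq_zero)
  then have "poly MCM x = poly ([:0, 1:] * [:1, 1:] ^ 5) x"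
    by (rule arg_cong)
  then show ?thesis
    by (simp add: g_def add.commute)
qed

theorem theorem11p7:
  fixes n :: nat
  assumes "odd n" and "CARD('a::{finite,field}) = 2 ^ n"
  shows "(\<forall>u::'a. u \<noteq> 0 \<and> v n u = 1 \<longrightarrow>
            (\<exists>!w. w \<in> V n u \<and> w \<noteq> 0) \<and>
            (\<forall>w. w \<in> V n u \<and> w \<noteq> 0 \<longrightarrow> T n u w = 1)) \<and>
         \<not> (\<exists>u::'a. u \<noteq> 0 \<and> v n u = 3 \<and> (\<forall>w\<in>V n u. T n u w = 0)) \<and>
         (\<forall>u::'a. G n 1 u = 0) \<and>
         ((\<forall>x::'a. g x = poly MCM x) \<and>
          (\<forall>y \<in> range (g :: 'a \<Rightarrow> 'a).
             card (g -` {y}) = 2 \<and>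
             card (g -` {y} \<inter> trace_fiber n 0) = 1 \<and>
             card (g -` {y} \<inter> trace_fiber n 1) = 1) \<and>
          poly MCM ` trace_fiber n 0 = (Delta :: 'a set) \<and>
          poly MCM ` trace_fiber n 1 = (Delta :: 'a set)) \<and>
         (\<forall>u::'a. u \<noteq> 0 \<longrightarrow>
            2 * S n u = H n u \<and> H n u = G n 0 u \<and>
            G n 0 u = (\<Sum>s\<in>UNIV. chi n (u * g s)))"
proof -
  interpret odd_binary_field n "TYPE('a)"
    by standard (use assms in auto)
  have "card (g -` {y}) = 2 \<and> card (g -` {y} \<inter> trace_fiber n 0) = 1 \<and>
      card (g -` {y} \<inter> trace_fiber n 1) = 1" if y: "y \<in> range (g :: 'a \<Rightarrow> 'a)" for y
  proof -
    obtain a b where ab: "g -` {y} = {a, b}" "Tr n a = 0" "Tr n b = 1"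
      using fiber_g_trace_fiber[OF y] .
    then have "a \<noteq> b" "{a, b} \<inter> trace_fiber n 0 = {a}" "{a, b} \<inter> trace_fiber n 1 = {b}"
      by (auto simp: trace_fiber_def)
    with ab(1) show ?thesis
      by simp
  qed
  moreover have "(poly MCM :: 'a \<Rightarrow> 'a) = g"
    by (rule ext) (rule poly_MCM)
  ultimately show ?thesis
    using V_dim_1 T_not_zero_on_V by (auto simp: G_1 image_g_eq_Delta H_eq G_0) (simp add: G_def flip: G_0)
qed

end
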